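(* Let $d=2$ and let the loss $\ell$ and the data distribution $\mathbb P$ on $\mathbb R^2\times\mathbb R$ satisfy the standing assumptions on loss, data and compatibility stated in the context. Let $\pi_0\in\mathcal P_2(\overline\Theta)$ and let $(\pi_t)_{t\ge0}$ be the Wasserstein gradient flow of $\mathcal R$ starting at $\pi_0$. Then the Morse-Sard condition holds: whenever $t_n\to\infty$ and $\delta_\pi\mathcal R(\pi_{t_n},\cdot)\to g$, $\nabla_\theta\delta_\pi\mathcal R(\pi_{t_n},\cdot)\to V$ locally uniformly on $\overline\Theta$, then for Lebesgue-a.e. $s\in\mathbb R$ the tangential gradient $\nabla^Sg(\theta)=(I-\theta\otimes\theta)V(\theta)$ does not vanish at any point of $\{\theta\in\overline\Theta:|\theta|=1,\ g(\theta)=s\}$.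
   Context: **Network.** For $d\ge 1$ let $\Theta=\{(a,w,b)\in\mathbb R\times\mathbb R^d\times\mathbb R: a^2<|w|^2+b^2\}$, with closure $\overline\Theta\subset\mathbb R^{d+2}$; write $\theta=(a,w,b)$. Let $\sigma(z)=\max\{z,0\}$, $\sigma'(z)=1_{\{z>0\}}$, $\phi(\theta;x)=a\,\sigma(w^Tx+b)$ and $\nabla_\theta\phi(\theta;x)=\big(\sigma(w^Tx+b),\,a\,\sigma'(w^Tx+b)\,x,\,a\,\sigma'(w^Tx+b)\big)$ for $x\in\mathbb R^d$. $\mathcal P_2(\overline\Theta)$ is the set of Borel probability measures on $\overline\Theta$ with finite second moment $N(\pi)=\int|\theta|^2\,\pi(d\theta)$, and $f_\pi(x)=\int_{\overline\Theta}\phi(\theta;x)\,\pi(d\theta)$. **Loss.** $\ell:\mathbb R\times\mathbb R\to[0,\infty)$ is jointly continuous, continuously differentiable in the first argument with $|\partial_1\ell|\le C_\ell$ for some constant $C_\ell$, and $y\mapsto\ell(y,\bar y)$ is convex for every $\bar y$. **Data.** $\mathbb P$ is a Borel probability measure on $\mathbb R^d\times\mathbb R$ with $\int(|x|+|y|)\,d\mathbb P<\infty$; $\overline{\mathbb P}$ is its marginal on $\mathbb R^d$ and $\mathbb P^x$ are the conditional distributions of $y$ given $x$. The span of $\{\phi(\theta;\cdot):\theta\in\Theta\}$ is dense in $L^1(\overline{\mathbb P})$, and the map $S^d\to L^1(\sqrt{1+|x|^2}\cdot\overline{\mathbb P})$, $(w,b)\mapsto 1_{\{x\,:\,w^Tx+b>0\}}$,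 is Lipschitz continuous (here $S^d\subset\mathbb R^{d+1}$ is the unit sphere and $h\cdot\mu$ is the measure with density $h$ with respect to $\mu$). **Compatibility.** With $L_x(\alpha)=\int_{\mathbb R}\ell(\alpha,y)\,\mathbb P^x(dy)$: $\lim_{|\alpha|\to\infty}L_x(\alpha)=\infty$ for $\overline{\mathbb P}$-a.e. $x$; $\int\ell(0,y)\,d\mathbb P<\infty$; and there is a $\overline{\mathbb P}$-measurable $f^*\in L^1(\overline{\mathbb P})$ with $f^*(x)\in\operatorname{argmin}_\alpha L_x(\alpha)$ for $\overline{\mathbb P}$-a.e. $x$. **Risk and gradient flow.** $\mathcal R(\pi)=\int\ell(f_\pi(x),y)\,\mathbb P(dx\otimes dy)$, $\delta_\pi\mathcal R(\pi,\theta)=\int(\partial_1\ell)(f_\pi(x),y)\,\phi(\theta;x)\,\mathbb P(dx\otimes dy)$, $\nabla_\theta\delta_\pi\mathcal R(\pi,\theta)=\int(\partial_1\ell)(f_\pi(x),y)\,\nabla_\theta\phi(\theta;x)\,\mathbb P(dx\otimes dy)$. The Wasserstein gradient flow starting at $\pi_0$ is the locally absolutely continuous curve $t\mapsto\pi_t\in\mathcal P_2(\overline\Theta)$ with respect to the 2-Wasserstein distance, with initial value $\pi_0$, satisfying $\partial_t\pi_t=\mathrm{div}_\theta(\pi_t\nabla_\theta\delta_\pi\mathcal R(\pi_t,\cdot))$ in the sense that $\frac{d}{dt}\int\psi\,d\pi_t=-\int\langle\nabla\psi,\nabla_\theta\delta_\pi\mathcal R(\pi_t,\cdot)\rangle\,d\pi_t$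 for a.e. $t>0$ and all $\psi\in C_c^\infty(\mathbb R^{d+2})$. *)

theory Defs
  imports "HOL-Probability.Probability"
begin

subsection \<open>Network\<close>

text \<open>The norm and inner product of the product type are the Euclidean ones in dimension \<open>d + 2\<close>.\<close>

type_synonym 'd param = "real \<times> (real ^ 'd) \<times> real"

definition Theta :: "('d::finite) param set" where
  "Theta = {(a, w, b). a\<^sup>2 < (norm w)\<^sup>2 + b\<^sup>2}"

definition relu :: "real \<Rightarrow> real" where
  "relu z = max z 0"

definition relu' :: "real \<Rightarrow> real" where
  "relu' z = (if z > 0 then 1 else 0)"

definition \<phi> :: "('d::finite) param \<Rightarrow> real ^ 'd \<Rightarrow> real" where
  "\<phi> = (\<lambda>(a, w, b) x. a * relu (w \<bullet> x + b))"

definition grad_\<phi> :: "('d::finite) param \<Rightarrow> real ^ 'd \<Rightarrow> 'd param" where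
  "grad_\<phi> = (\<lambda>(a, w, b) x.
     (relu (w \<bullet> x + b), (a * relu' (w \<bullet> x + b)) *\<^sub>R x, a * relu' (w \<bullet> x + b)))"

definition P2 :: "('d::finite) param measure set" where
  "P2 = {\<pi>. prob_space \<pi> \<and> sets \<pi> = sets (restrict_space borel (closure Theta)) \<and>
             integrable \<pi> (\<lambda>\<theta>. (norm \<theta>)\<^sup>2)}"

definition network :: "('d::finite) param measure \<Rightarrow> real ^ 'd \<Rightarrow> real" where
  "network \<pi> x = (\<integral>\<theta>. \<phi> \<theta> x \<partial>\<pi>)"


subsection \<open>Loss\<close>

definition d1_loss :: "(real \<Rightarrow> real \<Rightarrow> real) \<Rightarrow> real \<Rightarrow> real \<Rightarrow> real" where
  "d1_loss l u y = deriv (\<lambda>v. l v y) u"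

definition loss_assumption :: "(real \<Rightarrow> real \<Rightarrow> real) \<Rightarrow> bool" where
  "loss_assumption l \<longleftrightarrow>
     (\<forall>u y. 0 \<le> l u y) \<and>
     continuous_on UNIV (\<lambda>(u, y). l u y) \<and>
     (\<forall>y u. (\<lambda>v. l v y) differentiable (at u)) \<and>
     (\<forall>y. continuous_on UNIV (\<lambda>u. d1_loss l u y)) \<and>
     (\<exists>C. \<forall>u y. \<bar>d1_loss l u y\<bar> \<le> C) \<and>
     (\<forall>y. convex_on UNIV (\<lambda>u. l u y))"


subsection \<open>Data\<close>

definition marginal :: "((real ^ 'd::finite) \<times> real) measure \<Rightarrow> (real ^ 'd) measure" where
  "marginal P = distr P borel fst"

text \<open>In the second condition the functions \<open>\<phi> \<theta>\<close> and \<open>f\<close> are all \<open>marginal P\<close>-integrable, so the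
  integral is the distance in \<open>L\<^sup>1\<close>. In the third, \<open>sphere 0 1\<close> is the unit sphere of
  \<open>\<real>\<^sup>d \<times> \<real>\<close>.\<close>

definition data_assumption :: "((real ^ 'd::finite) \<times> real) measure \<Rightarrow> bool" where
  "data_assumption P \<longleftrightarrow>
     prob_space P \<and> sets P = sets borel \<and>
     integrable P (\<lambda>(x, y). norm x + \<bar>y\<bar>) \<and>
     (\<forall>f :: real ^ 'd \<Rightarrow> real. integrable (marginal P) f \<longrightarrow> (\<forall>\<epsilon>>0. \<exists>F c. finite F \<and> F \<subseteq> Theta \<and>
        (\<integral>x. \<bar>f x - (\<Sum>\<theta>\<in>F. c \<theta> * \<phi> \<theta> x)\<bar> \<partial>marginal P) < \<epsilon>)) \<and>
     (\<exists>L. \<forall>u \<in> sphere 0 1. \<forall>v \<in> sphere 0 1.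
        (\<integral>x. \<bar>indicator {x. fst u \<bullet> x + snd u > 0} x - indicator {x. fst v \<bullet> x + snd v > 0} x\<bar>
           \<partial>density (marginal P) (\<lambda>x. ennreal (sqrt (1 + (norm x)\<^sup>2)))) \<le> L * dist u v)"

text \<open>\<open>K x\<close> is (a version of) the conditional distribution of \<open>y\<close> given \<open>x\<close>, as a Markov kernel.\<close>

definition conditional_distribution ::
    "((real ^ 'd::finite) \<times> real) measure \<Rightarrow> (real ^ 'd \<Rightarrow> real measure) \<Rightarrow> bool" where
  "conditional_distribution P K \<longleftrightarrow>
     K \<in> borel \<rightarrow>\<^sub>M prob_algebra borel \<and>
     (\<forall>A \<in> sets borel. \<forall>B \<in> sets borel.
        emeasure P (A \<times> B) = (\<integral>\<^sup>+x\<in>A. emeasure (K x) B \<partial>marginal P))"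

text \<open>Since \<open>l\<close> is Lipschitz in its first argument and \<open>l 0\<close> is \<open>P\<close>-integrable, for
  \<open>marginal P\<close>-a.e. \<open>x\<close> the integrand of \<open>cond_loss\<close> is integrable for every \<open>\<alpha>\<close>; all conditions
  below are imposed only almost everywhere.\<close>

definition cond_loss :: "(real \<Rightarrow> real \<Rightarrow> real) \<Rightarrow> ('x \<Rightarrow> real measure) \<Rightarrow> 'x \<Rightarrow> real \<Rightarrow> real" where
  "cond_loss l K x \<alpha> = (\<integral>y. l \<alpha> y \<partial>K x)"

definition compatibility ::
    "(real \<Rightarrow> real \<Rightarrow> real) \<Rightarrow> ((real ^ 'd::finite) \<times> real) measure \<Rightarrow> (real ^ 'd \<Rightarrow> real measure) \<Rightarrow> bool"
  where
  "compatibility l P K \<longleftrightarrow>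
     (AE x in marginal P. filterlim (cond_loss l K x) at_top at_infinity) \<and>
     integrable P (\<lambda>(x, y). l 0 y) \<and>
     (\<exists>fstar. integrable (marginal P) fstar \<and>
        (AE x in marginal P. is_arg_min (cond_loss l K x) (\<lambda>_. True) (fstar x)))"


subsection \<open>Wasserstein gradient flow\<close>

definition dR :: "(real \<Rightarrow> real \<Rightarrow> real) \<Rightarrow> ((real ^ 'd::finite) \<times> real) measure \<Rightarrow>
    'd param measure \<Rightarrow> 'd param \<Rightarrow> real" where
  "dR l P \<pi> \<theta> = (\<integral>(x, y). d1_loss l (network \<pi> x) y * \<phi> \<theta> x \<partial>P)"

definition grad_dR :: "(real \<Rightarrow> real \<Rightarrow> real) \<Rightarrow> ((real ^ 'd::finite) \<times> real) measure \<Rightarrow>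
    'd param measure \<Rightarrow> 'd param \<Rightarrow> 'd param" where
  "grad_dR l P \<pi> \<theta> = (\<integral>(x, y). d1_loss l (network \<pi> x) y *\<^sub>R grad_\<phi> \<theta> x \<partial>P)"

definition couplings :: "'a measure \<Rightarrow> 'a measure \<Rightarrow> ('a \<times> 'a) measure set" where
  "couplings \<mu> \<nu> = {\<gamma>. sets \<gamma> = sets (\<mu> \<Otimes>\<^sub>M \<nu>) \<and> distr \<gamma> \<mu> fst = \<mu> \<and> distr \<gamma> \<nu> snd = \<nu>}"

text \<open>The infimum is finite for measures with finite second moment, the only ones to which
  \<open>W2\<close> is applied.\<close>

definition W2 :: "'a::metric_space measure \<Rightarrow> 'a measure \<Rightarrow> real" where
  "W2 \<mu> \<nu> = sqrt (enn2real
     (INF \<gamma> \<in> couplings \<mu> \<nu>. \<integral>\<^sup>+z. ennreal ((dist (fst z) (snd z))\<^sup>2) \<partial>\<gamma>))"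

text \<open>Local absolute continuity on \<open>[0, \<infinity>)\<close> of a curve in a metric space, in the usual form for
  Wasserstein space: increments are bounded by integrals of a locally integrable function.\<close>

definition W2_locally_AC :: "(real \<Rightarrow> 'a::metric_space measure) \<Rightarrow> bool" where
  "W2_locally_AC \<pi> \<longleftrightarrow>
     (\<exists>m. (\<forall>T\<ge>0. set_integrable lebesgue {0..T} m) \<and>
          (\<forall>s t. 0 \<le> s \<and> s \<le> t \<longrightarrow> W2 (\<pi> s) (\<pi> t) \<le> (LINT r:{s..t}|lebesgue. m r)))"

text \<open>\<open>C_fun k f\<close>: \<open>f\<close> is \<open>k\<close> times continuously differentiable, by recursion on the partial
  derivatives.\<close>

primrec C_fun :: "nat \<Rightarrow> ('a::euclidean_space \<Rightarrow> real) \<Rightarrow> bool" where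
  "C_fun 0 f \<longleftrightarrow> continuous_on UNIV f"
| "C_fun (Suc k) f \<longleftrightarrow> (\<forall>x. f differentiable (at x)) \<and>
     (\<forall>i \<in> Basis. C_fun k (\<lambda>x. frechet_derivative f (at x) i))"

definition test_function :: "('a::euclidean_space \<Rightarrow> real) \<Rightarrow> bool" where
  "test_function \<psi> \<longleftrightarrow> (\<forall>k. C_fun k \<psi>) \<and> compact (closure {x. \<psi> x \<noteq> 0})"

definition grad :: "('a::euclidean_space \<Rightarrow> real) \<Rightarrow> 'a \<Rightarrow> 'a" where
  "grad f x = (THE D. GDERIV f x :> D)"

definition wasserstein_gradient_flow :: "(real \<Rightarrow> real \<Rightarrow> real) \<Rightarrow> ((real ^ 'd::finite) \<times> real) measure \<Rightarrow>
    'd param measure \<Rightarrow> (real \<Rightarrow> 'd param measure) \<Rightarrow> bool" where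
  "wasserstein_gradient_flow l P \<pi>\<^sub>0 \<pi> \<longleftrightarrow>
     (\<forall>t\<ge>0. \<pi> t \<in> P2) \<and> \<pi> 0 = \<pi>\<^sub>0 \<and> W2_locally_AC \<pi> \<and>
     (AE t in lebesgue. t > 0 \<longrightarrow> (\<forall>\<psi>. test_function \<psi> \<longrightarrow>
        ((\<lambda>s. \<integral>\<theta>. \<psi> \<theta> \<partial>\<pi> s) has_real_derivative
           - (\<integral>\<theta>. grad \<psi> \<theta> \<bullet> grad_dR l P (\<pi> t) \<theta> \<partial>\<pi> t)) (at t)))"


subsection \<open>Morse-Sard condition\<close>

definition tangential :: "'a::real_inner \<Rightarrow> 'a \<Rightarrow> 'a" where
  "tangential \<theta> v = v - (\<theta> \<bullet> v) *\<^sub>R \<theta>"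

text \<open>As \<open>closure Theta\<close> is locally compact, locally uniform convergence is uniform convergence on
  its compact subsets.\<close>

definition locally_uniform_limit ::
    "'a::topological_space set \<Rightarrow> (nat \<Rightarrow> 'a \<Rightarrow> 'b::metric_space) \<Rightarrow> ('a \<Rightarrow> 'b) \<Rightarrow> bool" where
  "locally_uniform_limit S f g \<longleftrightarrow> (\<forall>C. compact C \<and> C \<subseteq> S \<longrightarrow> uniform_limit C f g sequentially)"

definition morse_sard_condition :: "(real \<Rightarrow> real \<Rightarrow> real) \<Rightarrow> ((real ^ 'd::finite) \<times> real) measure \<Rightarrow>
    (real \<Rightarrow> 'd param measure) \<Rightarrow> bool" where
  "morse_sard_condition l P \<pi> \<longleftrightarrow>
     (\<forall>(t :: nat \<Rightarrow> real) g V.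
        (\<forall>n. 0 \<le> t n) \<and> filterlim t at_top sequentially \<and>
        locally_uniform_limit (closure Theta) (\<lambda>n. dR l P (\<pi> (t n))) g \<and>
        locally_uniform_limit (closure Theta) (\<lambda>n. grad_dR l P (\<pi> (t n))) V \<longrightarrow>
        (AE s in lebesgue. \<forall>\<theta> \<in> {\<theta> \<in> closure Theta. norm \<theta> = 1 \<and> g \<theta> = s}.
           tangential \<theta> (V \<theta>) \<noteq> 0))"

end

theory Submission
  imports Defs
begin

text \<open>With \<open>u = (w, b)\<close> the linearised risk is \<open>a * H u\<close> for a function \<open>H\<close> that is positively
  homogeneous of degree one, so by Euler's identity the tangential gradient vanishes at \<open>(a, u)\<close> only if
  \<open>H u = 0\<close>, or \<open>a\<^sup>2 = 1/2\<close> and \<open>u\<close> points to a critical point of \<open>H\<close> on the unit sphere. The Lipschitz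
  condition on half-spaces gives a first-order Taylor formula for \<open>H\<close> on the sphere with quadratic
  remainder, uniform in time, which passes to the limit. It remains to prove the Morse-Sard theorem on a
  two-dimensional domain in the case of regularity \<open>C\<^sup>1\<^sup>,\<^sup>1\<close>, which reduces to a purely metric statement:
  if \<open>\<bar>G p - G q\<bar> \<le> M * (dist p q)\<^sup>2\<close> on a compact subset of the plane, then its image is null.\<close>

subsection \<open>Quadratic maps on planar sets\<close>

text \<open>The cells are the fibres of this map: half-open squares of side \<open>1 / n\<close>
  that partition the plane.\<close>

definition grid_cell :: "nat \<Rightarrow> real \<times> real \<Rightarrow> int \<times> int" where
  "grid_cell n p = (\<lfloor>real n * fst p\<rfloor>, \<lfloor>real n * snd p\<rfloor>)"

lemma dist_pair_le: "dist (p :: real \<times> real) q \<le> \<bar>fst p - fst q\<bar> + \<bar>snd p - snd q\<bar>"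
  by (simp add: dist_prod_def dist_real_def sqrt_sum_squares_le_sum_abs order_trans[OF sqrt_sum_squares_le_sum])

lemma abs_diff_le_of_floor_eq:
  assumes "0 < n" "\<lfloor>real n * x\<rfloor> = \<lfloor>real n * y\<rfloor>"
  shows "\<bar>x - y\<bar> \<le> 1 / n"
proof -
  have "\<bar>real n * x - real n * y\<bar> \<le> 1"
    using assms(2) by linarith
  then have "real n * \<bar>x - y\<bar> \<le> 1"
    by (simp add: abs_mult flip: right_diff_distrib)
  then show ?thesis
    using assms(1) by (simp add: field_simps)
qed

lemma dist_grid_cell:
  assumes "0 < n" "grid_cell n p = grid_cell n q"
  shows "dist p q \<le> 2 / n"
  using dist_pair_le[of p q] abs_diff_le_of_floor_eq[of n "fst p" "fst q"]
    abs_diff_le_of_floor_eq[of n "snd p" "snd q"] assms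
  by (simp add: grid_cell_def)

text \<open>The grids are nested: rounding down before or after division by \<open>N\<close> gives
  the same result, so the coarse index is the fine one \<open>div N\<close>.\<close>

lemma grid_cell_refine:
  assumes "0 < N" "grid_cell (m * N) p = grid_cell (m * N) q"
  shows "grid_cell m p = grid_cell m q"
proof -
  have "\<lfloor>real m * x\<rfloor> = \<lfloor>real (m * N) * x\<rfloor> div int N" for x
    using floor_divide_real_eq_div[of "int N" "real (m * N) * x"] assms(1) by simp
  then show ?thesis
    using assms(2) by (simp add: grid_cell_def)
qed

text \<open>The reals with a given floor form a half-open interval, which is convex; hence a segment
  between two points of a grid cell stays in the cell.\<close>

lemma floor_segment:
  fixes c x y u :: real
  assumes "\<lfloor>c * x\<rfloor> = k" "\<lfloor>c * y\<rfloor> = k" "0 \<le> u" "u \<le> 1"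
  shows "\<lfloor>c * (x + u * (y - x))\<rfloor> = k"
proof -
  have eq: "c * (x + u * (y - x)) = (1 - u) * (c * x) + u * (c * y)"
    by (simp add: algebra_simps)
  have "real_of_int k = (1 - u) * k + u * k"
    by (simp add: algebra_simps)
  also have "\<dots> \<le> (1 - u) * (c * x) + u * (c * y)"
    using assms by (intro add_mono mult_left_mono) linarith+
  finally have "k \<le> c * (x + u * (y - x))"
    using eq by simp
  moreover have "(1 - u) * (c * x) + u * (c * y) < k + 1"
    using assms by (intro convex_bound_lt) linarith+
  ultimately show ?thesis
    using eq by linarith
qed

lemma grid_cell_segment:
  assumes "grid_cell m x = k" "grid_cell m y = k" "0 \<le> u" "u \<le> 1"
  shows "grid_cell m (x + u *\<^sub>R (y - x)) = k"
  using assms floor_segment[of m "fst x" "fst k" "fst y" u] floor_segment[of m "snd x" "snd k" "snd y" u]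
  by (auto simp: grid_cell_def)

text \<open>Splitting a segment into \<open>N\<close> steps, each with quadratic error, gains a factor \<open>1 / N\<close> over the
  direct estimate.\<close>

lemma chain_in_cell:
  fixes G :: "real \<times> real \<Rightarrow> real"
  assumes "0 < m" "0 < N" "0 \<le> M"
    and quad: "\<And>p q. p \<in> A \<Longrightarrow> q \<in> A \<Longrightarrow> \<bar>G p - G q\<bar> \<le> M * (dist p q)\<^sup>2"
    and full: "\<And>p. grid_cell m p = k \<Longrightarrow> \<exists>q\<in>A. grid_cell (m * N) q = grid_cell (m * N) p"
    and x: "x \<in> A" "grid_cell m x = k" and y: "y \<in> A" "grid_cell m y = k"
  shows "\<bar>G x - G y\<bar> \<le> 36 * M / (real m ^ 2 * N)"
proof -
  define p where "p i = x + (real i / N) *\<^sub>R (y - x)" for i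
  have p0: "p 0 = x" and pN: "p N = y"
    using \<open>0 < N\<close> by (simp_all add: p_def)
  \<comment> \<open>The division points \<open>p i\<close> may miss \<open>A\<close>, so each is
    replaced by a point of \<open>A\<close> in its subcell. The two ends are kept exactly, so that
    the telescoping sum runs from \<open>x\<close> to \<open>y\<close>.\<close>
  have "\<exists>q. q \<in> A \<and> grid_cell (m * N) q = grid_cell (m * N) (p i) \<and> (i = 0 \<longrightarrow> q = x) \<and> (i = N \<longrightarrow> q = y)"
    if "i \<le> N" for i
  proof (cases "i = 0 \<or> i = N")
    case True
    then show ?thesis
      using x y p0 pN \<open>0 < N\<close> by metis
  next
    case False
    have "grid_cell m (p i) = k"
      unfolding p_def using x y that \<open>0 < N\<close> by (intro grid_cell_segment) auto
    then show ?thesis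
      using full False by metis
  qed
  then obtain q where q: "\<And>i. i \<le> N \<Longrightarrow> q i \<in> A"
      "\<And>i. i \<le> N \<Longrightarrow> grid_cell (m * N) (q i) = grid_cell (m * N) (p i)" "q 0 = x" "q N = y"
    by (metis le0 order_refl)
  have dqp: "dist (q i) (p i) \<le> 2 / (m * N)" if "i \<le> N" for i
    using dist_grid_cell[of "m * N" "q i" "p i"] q(2)[OF that] assms(1,2) by simp
  \<comment> \<open>The constant 6 adds three moves of length at most \<open>2 / (m * N)\<close>:
    from \<open>q (Suc i)\<close> to \<open>p (Suc i)\<close>, on to \<open>p i\<close>, and on to
    \<open>q i\<close>. The squared step has order \<open>1 / N^2\<close>, so the sum of
    \<open>N\<close> of them keeps a factor \<open>1 / N\<close>.\<close>
  have step: "\<bar>G (q (Suc i)) - G (q i)\<bar> \<le> M * (6 / (m * N))\<^sup>2" if "i < N" for i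
  proof -
    have "p (Suc i) - p i = (1 / N) *\<^sub>R (y - x)"
      by (simp add: p_def add_divide_distrib flip: scaleR_left_diff_distrib)
    then have "dist (p (Suc i)) (p i) = dist x y / N"
      by (simp add: dist_norm norm_minus_commute)
    also have "\<dots> \<le> (2 / m) / N"
      using dist_grid_cell[of m x y] x y assms(1) by (intro divide_right_mono) auto
    finally have "dist (p (Suc i)) (p i) \<le> 2 / (m * N)"
      by simp
    then have "dist (p (Suc i)) (q i) \<le> 2 / (m * N) + 2 / (m * N)"
      using dqp[OF less_imp_le[OF that]]
      \<open>dist (p (Suc i)) (p i) \<le> 2 / (m * N)\<close>
      by (intro order_trans[OF dist_triangle[of _ _ "p i"] add_mono]) (simp_all add: dist_commute)
    then have "dist (q (Suc i)) (q i) \<le> 2 / (m * N) + (2 / (m * N) + 2 / (m * N))"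
      by (rule order_trans[OF dist_triangle add_mono[OF dqp[OF Suc_leI[OF that]]]])
    then have "dist (q (Suc i)) (q i) \<le> 6 / (m * N)"
      by (simp add: mult.commute)
    then have "M * (dist (q (Suc i)) (q i))\<^sup>2 \<le> M * (6 / (m * N))\<^sup>2"
      using \<open>0 \<le> M\<close> by (intro mult_left_mono power_mono) auto
    then show ?thesis
      using quad[of "q (Suc i)" "q i"] q(1)[of "Suc i"] q(1)[of i] that by simp
  qed
  have "\<bar>G x - G y\<bar> = \<bar>\<Sum>i<N. G (q (Suc i)) - G (q i)\<bar>"
    using sum_lessThan_telescope[of "\<lambda>i. G (q i)" N] q(3,4) by simp
  also have "\<dots> \<le> (\<Sum>i<N. M * (6 / (m * N))\<^sup>2)"
    using step by (intro order_trans[OF sum_abs] sum_mono) auto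
  also have "\<dots> = 36 * M / (real m ^ 2 * N)"
    using assms(1,2) by (simp add: field_simps power2_eq_square)
  finally show ?thesis .
qed

section \<open>Area and number of grid cells\<close>

lemma grid_cell_vimage:
  assumes "0 < n"
  shows "grid_cell n -` {grid_cell n p} \<in> lmeasurable"
    and "measure lebesgue (grid_cell n -` {grid_cell n p}) = 1 / real n ^ 2"
proof -
  define a where "a = fst (grid_cell n p) / real n"
  define b where "b = snd (grid_cell n p) / real n"
  have [simp]: "real n * a = fst (grid_cell n p)" "real n * b = snd (grid_cell n p)"
    using assms by (simp_all add: a_def b_def)
  have fl: "\<lfloor>real n * x\<rfloor> = k \<longleftrightarrow> k / real n \<le> x \<and> x < k / real n + 1 / n" for x k
    using assms by (auto simp: floor_eq_iff field_simps)
  have eq: "grid_cell n -` {grid_cell n p} = {a..<a + 1 / n} \<times> {b..<b + 1 / n}"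
    by (auto simp: grid_cell_def fl a_def b_def)
  have "emeasure (lborel \<Otimes>\<^sub>M lborel) ({a..<a + 1 / n} \<times> {b..<b + 1 / n}) = ennreal (1 / n) * ennreal (1 / n)"
    by (subst lborel.emeasure_pair_measure_Times) auto
  then have em: "emeasure lborel (grid_cell n -` {grid_cell n p}) = ennreal (1 / real n ^ 2)"
    unfolding eq lborel_prod by (simp add: power2_eq_square flip: ennreal_mult)
  have B: "grid_cell n -` {grid_cell n p} \<in> sets borel"
    unfolding eq by (intro borel_Times) auto
  have em': "emeasure lebesgue (grid_cell n -` {grid_cell n p}) = ennreal (1 / real n ^ 2)"
    using em B by simp
  show "grid_cell n -` {grid_cell n p} \<in> lmeasurable"
    using em' B by (auto intro!: fmeasurableI)
  show "measure lebesgue (grid_cell n -` {grid_cell n p}) = 1 / real n ^ 2"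
    using em' by (simp add: measure_def)
qed

text \<open>Both coordinates of a point of \<open>A\<close> have their indices between
  \<open>- R * m\<close> and \<open>R * m\<close>, which leaves \<open>2 * R * m + 1\<close>
  integers per axis.\<close>

lemma grid_cell_bounded:
  assumes "0 < m" "\<And>p. p \<in> A \<Longrightarrow> norm p \<le> real R"
  shows "finite (grid_cell m ` A)" "card (grid_cell m ` A) \<le> (2 * R * m + 1)\<^sup>2"
proof -
  let ?I = "{- int (R * m)..int (R * m)}"
  have cI: "card ?I = 2 * (R * m) + 1"
    unfolding card_atLeastAtMost_int by linarith
  have fl: "\<lfloor>real m * x\<rfloor> \<in> ?I" if "\<bar>x\<bar> \<le> R" for x :: real
  proof -
    have "\<bar>real m * x\<bar> \<le> real (R * m)"
      using that assms(1) by (simp add: abs_mult mult.commute mult_right_mono)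
    then show ?thesis
      by (simp add: abs_le_iff le_floor_iff floor_le_iff)
  qed
  have sub: "grid_cell m ` A \<subseteq> ?I \<times> ?I"
  proof
    fix k assume "k \<in> grid_cell m ` A"
    then obtain p where p: "p \<in> A" "k = grid_cell m p"
      by blast
    have "\<bar>fst p\<bar> \<le> R" "\<bar>snd p\<bar> \<le> R"
      using assms(2)[OF p(1)] norm_fst_le[of "fst p" "snd p"] norm_snd_le[of "snd p" "fst p"] by auto
    then show "k \<in> ?I \<times> ?I"
      unfolding p(2) grid_cell_def using fl by blast
  qed
  then show "finite (grid_cell m ` A)"
    by (rule finite_subset) auto
  have "card (grid_cell m ` A) \<le> card (?I \<times> ?I)"
    using sub by (intro card_mono) auto
  also have "\<dots> = (2 * R * m + 1)\<^sup>2"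
    using cI by (simp only: card_cartesian_product power2_eq_square mult.assoc)
  finally show "card (grid_cell m ` A) \<le> (2 * R * m + 1)\<^sup>2" .
qed

text \<open>Cut the plane into cells of side \<open>1 / m\<close> and these into subcells of side \<open>1 / (m N)\<close>. If every
  subcell of a cell meets \<open>A\<close>, chaining through \<open>A\<close> makes the image of the cell shorter by the factor
  \<open>1 / N\<close>. The other cells meeting \<open>A\<close> (the set \<open>B\<close> below) each contribute an empty subcell to \<open>U - A\<close>,
  so outer regularity makes them few.\<close>

lemma quadratic_image_negligible:
  fixes G :: "real \<times> real \<Rightarrow> real"
  assumes "compact A"
    and quad: "\<And>p q. p \<in> A \<Longrightarrow> q \<in> A \<Longrightarrow> \<bar>G p - G q\<bar> \<le> M * (dist p q)\<^sup>2"
  shows "negligible (G ` A)"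
proof (cases "A = {}")
  case False
  have quad': "\<bar>G p - G q\<bar> \<le> \<bar>M\<bar> * (dist p q)\<^sup>2" if "p \<in> A" "q \<in> A" for p q
    using quad[OF that] abs_ge_self[of M] mult_right_mono[of M "\<bar>M\<bar>" "(dist p q)\<^sup>2"] by force
  obtain R0 where R0: "\<And>p. p \<in> A \<Longrightarrow> norm p \<le> R0"
    using compact_imp_bounded[OF assms(1)] bounded_iff by blast
  \<comment> \<open>The bound \<open>1 \<le> R\<close> is what turns \<open>2 * R * m + 1\<close>
    into \<open>3 * R * m\<close> in the count of cells.\<close>
  obtain R :: nat where R: "max 1 R0 \<le> real R"
    using real_arch_simple by blast
  have "1 \<le> R"
    using R by simp
  have RA: "norm p \<le> real R" if "p \<in> A" for p
    using R0[OF that] R by simp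
  \<comment> \<open>The total length of the covering intervals, times \<open>N\<close>: at most
    \<open>9 * R^2 * m^2\<close> intervals of length
    \<open>2 * 36 * \<bar>M\<bar> / (m^2 * N)\<close>, and at most \<open>m^2 / N\<close>
    exceptional ones of length \<open>2 * 4 * \<bar>M\<bar> / m^2\<close>. The scale
    \<open>m\<close> cancels.\<close>
  define c where "c = 648 * \<bar>M\<bar> * real R ^ 2 + 8 * \<bar>M\<bar>"
  have main: "\<exists>T. G ` A \<subseteq> T \<and> T \<in> lmeasurable \<and> measure lebesgue T \<le> c / N" if "0 < N" for N :: nat
  proof -
    \<comment> \<open>An empty subcell has area \<open>1 / (m * N)^2\<close>, so an excess area
      below \<open>1 / N^3\<close> leaves room for at most \<open>m^2 / N\<close> of them, whatever
      \<open>m\<close> is.\<close>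
    obtain U where U: "open U" "A \<subseteq> U" "U - A \<in> lmeasurable" "emeasure lebesgue (U - A) < ennreal (1 / real N ^ 3)"
      using sets_lebesgue_outer_open[of A "1 / real N ^ 3"] assms(1) \<open>0 < N\<close>
      by (auto simp: compact_imp_closed borel_closed)
    have mU: "measure lebesgue (U - A) \<le> 1 / real N ^ 3"
      using U(3,4) by (simp add: emeasure_eq_measure2 ennreal_less_iff less_imp_le)
    obtain d where d: "0 < d" "{x. infdist x A \<le> d} \<subseteq> U"
      using compact_in_open_separated[OF False assms(1) U(1,2)] by blast
    \<comment> \<open>Cells that meet \<open>A\<close> have diameter at most
      \<open>2 / m \<le> d\<close> and so stay inside \<open>U\<close>.\<close>
    obtain m :: nat where m: "2 / d < real m"
      using reals_Archimedean2 by blast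
    have "0 < m"
      using m d(1) by (metis divide_pos_pos less_trans of_nat_0_less_iff zero_less_numeral)
    have "2 / real m \<le> d"
      using m d(1) \<open>0 < m\<close> by (simp add: field_simps)
    have cellU: "p \<in> U" if "x \<in> A" "grid_cell m p = grid_cell m x" for p x
    proof -
      have "infdist p A \<le> dist p x"
        using that(1) by (rule infdist_le)
      also have "\<dots> \<le> d"
        using dist_grid_cell[OF \<open>0 < m\<close> that(2)] \<open>2 / real m \<le> d\<close> by simp
      finally show ?thesis
        using d(2) by blast
    qed
    define I where "I = grid_cell m ` A"
    define B where "B = {k \<in> I. \<exists>p. grid_cell m p = k \<and> (\<forall>q\<in>A. grid_cell (m * N) q \<noteq> grid_cell (m * N) p)}"
    have finI: "finite I"
      using grid_cell_bounded[OF \<open>0 < m\<close> RA] by (simp add: I_def)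
    have "card I \<le> (2 * R * m + 1)\<^sup>2"
      using grid_cell_bounded[OF \<open>0 < m\<close> RA] by (simp add: I_def)
    also have "\<dots> \<le> (3 * R * m)\<^sup>2"
      using \<open>1 \<le> R\<close> \<open>0 < m\<close> mult_le_mono[of 1 R 1 m] by (intro power_mono) auto
    finally have "card I \<le> (3 * R * m)\<^sup>2" .
    then have "real (card I) \<le> real ((3 * R * m)\<^sup>2)"
      using of_nat_mono by blast
    then have cardI: "real (card I) \<le> 9 * real R ^ 2 * real m ^ 2"
      by (simp add: power_mult_distrib)
    have "B \<subseteq> I" "finite B"
      using finI by (auto simp: B_def)
    have "\<exists>p. \<forall>k\<in>B. grid_cell m (p k) = k \<and> (\<forall>q\<in>A. grid_cell (m * N) q \<noteq> grid_cell (m * N) (p k))"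
      by (rule bchoice) (auto simp: B_def)
    then obtain p where p: "\<And>k. k \<in> B \<Longrightarrow> grid_cell m (p k) = k"
        "\<And>k q. k \<in> B \<Longrightarrow> q \<in> A \<Longrightarrow> grid_cell (m * N) q \<noteq> grid_cell (m * N) (p k)"
      by blast
    define F where "F k = grid_cell (m * N) -` {grid_cell (m * N) (p k)}" for k
    have F: "F k \<in> lmeasurable" "measure lebesgue (F k) = 1 / real (m * N) ^ 2" for k
      unfolding F_def using grid_cell_vimage[of "m * N" "p k"] \<open>0 < m\<close> \<open>0 < N\<close> by auto
    have Fcell: "grid_cell m x = k" if "k \<in> B" "x \<in> F k" for k x
      using grid_cell_refine[OF \<open>0 < N\<close>, of m x "p k"] that p(1) by (simp add: F_def)
    have "pairwise (\<lambda>i j. disjnt (F i) (F j)) B"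
      unfolding pairwise_def disjnt_iff using Fcell by metis
    then have "measure lebesgue (\<Union>k\<in>B. F k) = (\<Sum>k\<in>B. measure lebesgue (F k))"
      using F(1) \<open>finite B\<close> by (intro measure_UNION') auto
    then have "card B * (1 / real (m * N) ^ 2) = measure lebesgue (\<Union>k\<in>B. F k)"
      by (simp add: F(2))
    also have "\<dots> \<le> measure lebesgue (U - A)"
    proof (intro measure_mono_fmeasurable)
      show "(\<Union>k\<in>B. F k) \<subseteq> U - A"
      proof (rule subsetI, elim UN_E, rule DiffI)
        fix k x assume k: "k \<in> B" and x: "x \<in> F k"
        obtain a where "a \<in> A" "grid_cell m a = k"
          using k \<open>B \<subseteq> I\<close> by (auto simp: I_def)
        then show "x \<in> U"
          using cellU Fcell[OF k x] by metis
        show "x \<notin> A"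
          using p(2)[OF k] x unfolding F_def by blast
      qed
      show "(\<Union>k\<in>B. F k) \<in> sets lebesgue"
        using F(1) \<open>finite B\<close> by blast
    qed (use U(3) in auto)
    also note mU
    finally have cardB: "real (card B) \<le> real m ^ 2 / N"
      using \<open>0 < m\<close> \<open>0 < N\<close> by (simp add: field_simps power_mult_distrib eval_nat_numeral)
    define x where "x = inv_into A (grid_cell m)"
    have x: "x k \<in> A" "grid_cell m (x k) = k" if "k \<in> I" for k
      using that unfolding x_def I_def by (auto intro: inv_into_into f_inv_into_f)
    \<comment> \<open>Radius about the sampled value: on \<open>B\<close> the direct quadratic
      estimate over the diameter \<open>2 / m\<close>, elsewhere the chaining estimate.\<close>
    define r where "r k = (if k \<in> B then 4 * \<bar>M\<bar> / real m ^ 2 else 36 * \<bar>M\<bar> / (real m ^ 2 * N))" for k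
    have r: "\<bar>G a - G (x k)\<bar> \<le> r k" if a: "a \<in> A" "grid_cell m a = k" for a k
    proof -
      have k: "k \<in> I"
        using a by (auto simp: I_def)
      show ?thesis
      proof (cases "k \<in> B")
        case True
        have "dist a (x k) \<le> 2 / m"
          using dist_grid_cell[OF \<open>0 < m\<close>] x[OF k] a by simp
        then have "\<bar>M\<bar> * (dist a (x k))\<^sup>2 \<le> \<bar>M\<bar> * (2 / m)\<^sup>2"
          by (intro mult_left_mono power_mono) auto
        then show ?thesis
          using quad'[OF a(1) x(1)[OF k]] True by (simp add: r_def power_divide mult.commute)
      next
        case False
        have "\<exists>q\<in>A. grid_cell (m * N) q = grid_cell (m * N) p" if "grid_cell m p = k" for p
          using False k that unfolding B_def by blast
        then show ?thesis
          using chain_in_cell[OF \<open>0 < m\<close> \<open>0 < N\<close> _ quad' _ a x[OF k]] False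
          by (simp add: r_def)
      qed
    qed
    have r0: "0 \<le> r k" for k
      by (simp add: r_def)
    let ?T = "\<Union>k\<in>I. cball (G (x k)) (r k)"
    have "measure lebesgue ?T \<le> (\<Sum>k\<in>I. measure lebesgue (cball (G (x k)) (r k)))"
      using finI by (intro measure_UNION_le) auto
    also have "\<dots> = (\<Sum>k\<in>I. 2 * r k)"
      using r0 by (simp add: cball_eq_atLeastAtMost)
    also have "\<dots> = (\<Sum>k\<in>B. 8 * \<bar>M\<bar> / real m ^ 2) + (\<Sum>k\<in>I - B. 72 * \<bar>M\<bar> / (real m ^ 2 * N))"
      using sum.subset_diff[OF \<open>B \<subseteq> I\<close> finI, of "\<lambda>k. 2 * r k"] by (simp add: r_def)
    also have "\<dots> = card B * (8 * \<bar>M\<bar> / real m ^ 2) + card (I - B) * (72 * \<bar>M\<bar> / (real m ^ 2 * N))"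
      by simp
    also have "\<dots> \<le> (real m ^ 2 / N) * (8 * \<bar>M\<bar> / real m ^ 2)
        + (9 * real R ^ 2 * real m ^ 2) * (72 * \<bar>M\<bar> / (real m ^ 2 * N))"
    proof (intro add_mono mult_right_mono)
      have "card (I - B) \<le> card I"
        using finI by (intro card_mono) auto
      then show "real (card (I - B)) \<le> 9 * real R ^ 2 * real m ^ 2"
        using cardI by linarith
    qed (use cardB in auto)
    also have "\<dots> = c / N"
      using \<open>0 < m\<close> \<open>0 < N\<close> by (simp add: c_def field_simps)
    finally have "measure lebesgue ?T \<le> c / N" .
    moreover have "?T \<in> lmeasurable"
      using finI by (intro fmeasurable.finite_UN) auto
    moreover have "G ` A \<subseteq> ?T"
    proof clarify
      fix a assume "a \<in> A"
      then show "G a \<in> ?T"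
        using r[of a "grid_cell m a"] by (force simp: I_def dist_real_def abs_minus_commute)
    qed
    ultimately show ?thesis
      by blast
  qed
  show ?thesis
    unfolding negligible_outer_le
  proof (intro allI impI)
    fix e :: real assume "0 < e"
    obtain N :: nat where N: "max 0 (c / e) < real N"
      using reals_Archimedean2 by blast
    then have "c / N \<le> e" "0 < N"
      using \<open>0 < e\<close> by (auto simp: field_simps)
    then show "\<exists>T. G ` A \<subseteq> T \<and> T \<in> lmeasurable \<and> measure lebesgue T \<le> e"
      using main[of N] order_trans by blast
  qed
qed auto

subsection \<open>Critical values on the sphere\<close>

text \<open>Longitude and latitude. A Lipschitz map from a square onto the sphere is what carries
  the planar result over.\<close>

definition spherical :: "real \<times> real \<Rightarrow> (real ^ 2) \<times> real" where
  "spherical p = (vector [cos (snd p) * cos (fst p), cos (snd p) * sin (fst p)], sin (snd p))"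

lemma norm_vec2: "norm (w :: real ^ 2) ^ 2 = (w $ 1)\<^sup>2 + (w $ 2)\<^sup>2"
  by (simp add: norm_vec_def L2_set_def sum_2)

text \<open>The circle is parametrised twice: first for the unit vector \<open>(norm w, b)\<close>,
  then for \<open>w\<close> divided by its norm. At the poles \<open>w = 0\<close>, and any
  longitude works.\<close>

lemma spherical_surj:
  assumes "norm u = 1"
  shows "\<exists>p \<in> cbox (0, 0) (2 * pi, 2 * pi). spherical p = u"
proof -
  obtain w b where u: "u = (w, b)"
    by (cases u)
  have "(norm w)\<^sup>2 + b\<^sup>2 = 1"
    using assms by (simp add: u norm_Pair)
  then obtain \<beta> where \<beta>: "0 \<le> \<beta>" "\<beta> < 2 * pi" "norm w = cos \<beta>" "b = sin \<beta>"
    by (rule sincos_total_2pi)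
  obtain \<alpha> where \<alpha>: "0 \<le> \<alpha>" "\<alpha> < 2 * pi" "w $ 1 = norm w * cos \<alpha>" "w $ 2 = norm w * sin \<alpha>"
  proof (cases "w = 0")
    case True
    then show ?thesis
      using that[of 0] by simp
  next
    case False
    have "(w $ 1 / norm w)\<^sup>2 + (w $ 2 / norm w)\<^sup>2 = 1"
      unfolding power_divide add_divide_distrib[symmetric] norm_vec2[symmetric] using False by simp
    then obtain t where "0 \<le> t" "t < 2 * pi" "w $ 1 / norm w = cos t" "w $ 2 / norm w = sin t"
      by (rule sincos_total_2pi)
    then show ?thesis
      using that[of t] False by (simp add: field_simps)
  qed
  have "spherical (\<alpha>, \<beta>) = u"
    using \<alpha> \<beta> by (simp add: spherical_def u vec_eq_iff forall_2)
  then show ?thesis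
    using \<alpha> \<beta> by (intro bexI[of _ "(\<alpha>, \<beta>)"]) (auto simp: cbox_Pair_eq)
qed

lemma abs_cos_diff_le: "\<bar>cos x - cos y\<bar> \<le> \<bar>x - y :: real\<bar>"
proof -
  have "\<bar>cos x - cos y\<bar> = 2 * \<bar>sin ((x + y) / 2)\<bar> * \<bar>sin ((y - x) / 2)\<bar>"
    by (simp add: cos_diff_cos abs_mult)
  also have "\<dots> \<le> 2 * 1 * \<bar>(y - x) / 2\<bar>"
    by (intro mult_mono abs_sin_x_le_abs_x) auto
  finally show ?thesis
    by simp
qed

lemma abs_sin_diff_le: "\<bar>sin x - sin y\<bar> \<le> \<bar>x - y :: real\<bar>"
  using abs_cos_diff_le[of "pi / 2 - x" "pi / 2 - y"] by (simp add: cos_diff abs_minus_commute)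

lemma abs_mult_diff_le:
  fixes a b c d :: real
  assumes "\<bar>b\<bar> \<le> 1" "\<bar>c\<bar> \<le> 1"
  shows "\<bar>a * b - c * d\<bar> \<le> \<bar>a - c\<bar> + \<bar>b - d\<bar>"
proof -
  have "a * b - c * d = (a - c) * b + c * (b - d)"
    by (simp add: algebra_simps)
  also have "\<bar>\<dots>\<bar> \<le> \<bar>a - c\<bar> * 1 + 1 * \<bar>b - d\<bar>"
    unfolding abs_mult[symmetric]
    by (rule order_trans[OF abs_triangle_ineq]) (auto simp: abs_mult intro!: add_mono mult_mono assms mult_left_le mult_left_le_one_le)
  finally show ?thesis
    by simp
qed

text \<open>Each of the two products of trigonometric functions contributes 2 to the constant, and
  the height contributes 1.\<close>

lemma spherical_lipschitz: "dist (spherical p) (spherical q) \<le> 5 * dist p q"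
proof -
  have d: "\<bar>fst p - fst q\<bar> \<le> dist p q" "\<bar>snd p - snd q\<bar> \<le> dist p q"
    using dist_fst_le[of p q] dist_snd_le[of p q] by (simp_all add: dist_real_def)
  let ?w = "fst (spherical p) - fst (spherical q)"
  have "\<bar>?w $ 1\<bar> \<le> 2 * dist p q"
    using abs_mult_diff_le[of "cos (fst p)" "cos (snd q)" "cos (snd p)" "cos (fst q)"]
      abs_cos_diff_le[of "fst p" "fst q"] abs_cos_diff_le[of "snd p" "snd q"] d
    by (simp add: spherical_def)
  moreover have "\<bar>?w $ 2\<bar> \<le> 2 * dist p q"
    using abs_mult_diff_le[of "sin (fst p)" "cos (snd q)" "cos (snd p)" "sin (fst q)"]
      abs_sin_diff_le[of "fst p" "fst q"] abs_cos_diff_le[of "snd p" "snd q"] d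
    by (simp add: spherical_def)
  ultimately have "norm ?w \<le> 4 * dist p q"
    using norm_le_l1_cart[of ?w] by (simp add: sum_2)
  moreover have "norm (snd (spherical p) - snd (spherical q)) \<le> dist p q"
    using abs_sin_diff_le[of "snd p" "snd q"] d by (simp add: spherical_def)
  moreover have "dist (spherical p) (spherical q) \<le> norm ?w + norm (snd (spherical p) - snd (spherical q))"
    using norm_Pair_le[of ?w "snd (spherical p) - snd (spherical q)"] by (simp add: dist_norm flip: minus_prod_def)
  ultimately show ?thesis
    by linarith
qed

text \<open>The condition expresses criticality of \<open>u\<close> without derivatives, as the
  absence of a first-order term. Pulled back to the square of angles, such points form a compact set
  to which the planar result applies.\<close>

lemma quadratic_critical_values_negligible:
  fixes h :: "(real ^ 2) \<times> real \<Rightarrow> real"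
  assumes "continuous_on (sphere 0 1) h"
  shows "negligible (h ` {u \<in> sphere 0 1. \<forall>v \<in> sphere 0 1. \<bar>h v - h u\<bar> \<le> M * (dist v u)\<^sup>2})"
proof -
  let ?S = "{u \<in> sphere 0 1. \<forall>v \<in> sphere 0 1. \<bar>h v - h u\<bar> \<le> M * (dist v u)\<^sup>2}"
  define A where "A = cbox (0, 0) (2 * pi, 2 * pi) \<inter> spherical -` ?S"
  \<comment> \<open>For fixed \<open>v\<close> the condition on \<open>u\<close> is closed, and so
    is the intersection over all \<open>v\<close>; compactness of \<open>A\<close> rests on
    this.\<close>
  have "closed {u \<in> sphere 0 1. \<bar>h v - h u\<bar> \<le> M * (dist v u)\<^sup>2}" for v
    by (intro continuous_on_closed_Collect_le continuous_intros assms) auto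
  then have "closed (sphere 0 1 \<inter> (\<Inter>v \<in> sphere 0 1. {u \<in> sphere 0 1. \<bar>h v - h u\<bar> \<le> M * (dist v u)\<^sup>2}))"
    by (intro closed_Int closed_INT) auto
  also have "sphere 0 1 \<inter> (\<Inter>v \<in> sphere 0 1. {u \<in> sphere 0 1. \<bar>h v - h u\<bar> \<le> M * (dist v u)\<^sup>2}) = ?S"
    by auto
  finally have "closed ?S" .
  moreover have "5-lipschitz_on (cbox (0, 0) (2 * pi, 2 * pi)) spherical"
    using spherical_lipschitz by (intro lipschitz_onI) auto
  ultimately have "closed A"
    unfolding A_def by (intro continuous_closed_preimage lipschitz_on_continuous_on) auto
  then have "compact A"
    unfolding compact_eq_bounded_closed
    by (auto simp: A_def intro: bounded_subset[OF bounded_cbox[of "(0, 0)" "(2 * pi, 2 * pi)"]])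
  moreover have "\<bar>h (spherical p) - h (spherical q)\<bar> \<le> \<bar>M\<bar> * 25 * (dist p q)\<^sup>2" if "p \<in> A" "q \<in> A" for p q
  proof -
    have "\<bar>h (spherical p) - h (spherical q)\<bar> \<le> M * (dist (spherical p) (spherical q))\<^sup>2"
      using that by (auto simp: A_def)
    also have "\<dots> \<le> \<bar>M\<bar> * (5 * dist p q)\<^sup>2"
      by (intro mult_mono power_mono spherical_lipschitz) auto
    finally show ?thesis
      by (simp add: power_mult_distrib)
  qed
  ultimately have "negligible ((\<lambda>p. h (spherical p)) ` A)"
    by (rule quadratic_image_negligible)
  moreover have "h ` ?S \<subseteq> (\<lambda>p. h (spherical p)) ` A"
  proof
    fix s assume "s \<in> h ` ?S"
    then obtain u where u: "u \<in> ?S" "s = h u"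
      by blast
    then obtain p where "p \<in> cbox (0, 0) (2 * pi, 2 * pi)" "spherical p = u"
      using spherical_surj[of u] by auto
    then show "s \<in> (\<lambda>p. h (spherical p)) ` A"
      using u unfolding A_def by blast
  qed
  ultimately show ?thesis
    by (rule negligible_subset)
qed

subsection \<open>Weighted ridge integrals\<close>

text \<open>The data point in homogeneous coordinates: with \<open>u = (w, b)\<close> the
  preactivation is linear in \<open>u\<close>, and the norm of the feature is the density in the
  half-space condition.\<close>

definition feature :: "'a \<times> real \<Rightarrow> 'a \<times> real" where
  "feature z = (fst z, 1)"

lemma inner_feature: "u \<bullet> feature z = fst u \<bullet> fst z + snd u"
  by (simp add: feature_def inner_prod_def)

lemma norm_feature: "norm (feature z) = sqrt (1 + (norm (fst z))\<^sup>2)"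
  by (simp add: feature_def norm_Pair add.commute)

lemma feature_borel_measurable [measurable]:
  "feature \<in> borel_measurable (borel :: ('a::euclidean_space \<times> real) measure)"
  unfolding feature_def[abs_def] by (intro borel_measurable_continuous_onI continuous_intros)

text \<open>With the loss derivative as weight \<open>p\<close>, this is the function
  \<open>H\<close> that multiplies \<open>a\<close> in the linearised risk.\<close>

definition ridge_integral :: "((real ^ 'd::finite) \<times> real) measure \<Rightarrow> ((real ^ 'd) \<times> real \<Rightarrow> real) \<Rightarrow>
    (real ^ 'd) \<times> real \<Rightarrow> real" where
  "ridge_integral P p u = (\<integral>z. p z * relu (u \<bullet> feature z) \<partial>P)"

text \<open>The formal gradient of \<open>ridge_integral\<close>, taken under the integral with
  value 0 at the kink.\<close>

definition ridge_gradient :: "((real ^ 'd::finite) \<times> real) measure \<Rightarrow> ((real ^ 'd) \<times> real \<Rightarrow> real) \<Rightarrow>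
    (real ^ 'd) \<times> real \<Rightarrow> (real ^ 'd) \<times> real" where
  "ridge_gradient P p u = (\<integral>z. (p z * relu' (u \<bullet> feature z)) *\<^sub>R feature z \<partial>P)"

lemma relu_eq: "relu' r * r = relu r"
  by (simp add: relu_def relu'_def)

lemma relu_scale: "0 < c \<Longrightarrow> relu (c * r) = c * relu r"
  by (simp add: relu_def max_mult_distrib_left)

lemma relu'_scale: "0 < c \<Longrightarrow> relu' (c * r) = relu' r"
  by (simp add: relu'_def zero_less_mult_iff)

lemma abs_relu_le: "\<bar>relu r\<bar> \<le> \<bar>r\<bar>"
  by (simp add: relu_def)

lemma abs_relu'_le: "\<bar>relu' r\<bar> \<le> 1"
  by (simp add: relu'_def)

lemma abs_relu_diff_le: "\<bar>relu r - relu s\<bar> \<le> \<bar>r - s\<bar>"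
  by (auto simp: relu_def)

text \<open>Where the two derivatives differ, \<open>r\<close> and \<open>s\<close> have opposite signs, so that \<open>\<bar>r\<bar> \<le> \<bar>r - s\<bar>\<close>.\<close>

lemma relu_taylor: "\<bar>relu r - relu s - relu' s * (r - s)\<bar> \<le> \<bar>relu' r - relu' s\<bar> * \<bar>r - s\<bar>"
  by (auto simp: relu_def relu'_def)

section \<open>Measurability of the network and of the loss weight\<close>

lemma relu_measurable [measurable]: "relu \<in> borel_measurable borel"
  unfolding relu_def by measurable

lemma relu'_measurable [measurable]: "relu' \<in> borel_measurable borel"
  unfolding relu'_def by measurable

text \<open>The derivative is assumed continuous only in its first argument, for each
  \<open>y\<close>. It is jointly measurable as the pointwise limit of difference quotients of the
  jointly continuous \<open>l\<close>.\<close>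

lemma d1_loss_measurable:
  assumes "loss_assumption l"
  shows "(\<lambda>(u, y). d1_loss l u y) \<in> borel_measurable borel"
proof -
  have "continuous_on UNIV (\<lambda>(u, y). l u y)"
    using assms by (simp add: loss_assumption_def)
  then have l: "(\<lambda>(u, y). l u y) \<in> borel_measurable borel"
    by (rule borel_measurable_continuous_onI)
  have meas: "(\<lambda>z. (l (fst z + 1 / real (Suc n)) (snd z) - l (fst z) (snd z)) / (1 / real (Suc n)))
      \<in> borel_measurable (borel :: (real \<times> real) measure)" for n
  proof -
    have "(\<lambda>z. (fst z + 1 / real (Suc n), snd z)) \<in> borel \<rightarrow>\<^sub>M (borel :: (real \<times> real) measure)"
      by (intro borel_measurable_continuous_onI continuous_intros)
    from measurable_compose[OF this l]
    have "(\<lambda>z. l (fst z + 1 / real (Suc n)) (snd z)) \<in> borel_measurable borel"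
      by simp
    moreover have "(\<lambda>z. l (fst z) (snd z)) \<in> borel_measurable borel"
      using l by (simp add: case_prod_beta')
    ultimately show ?thesis
      by (intro borel_measurable_divide borel_measurable_diff) auto
  qed
  have "(\<lambda>n. (l (fst z + 1 / real (Suc n)) (snd z) - l (fst z) (snd z)) / (1 / real (Suc n)))
      \<longlonglongrightarrow> d1_loss l (fst z) (snd z)" for z
  proof -
    have "(\<lambda>v. l v (snd z)) differentiable (at (fst z))"
      using assms by (simp add: loss_assumption_def)
    then have "((\<lambda>v. l v (snd z)) has_field_derivative d1_loss l (fst z) (snd z)) (at (fst z))"
      unfolding d1_loss_def by (metis DERIV_deriv_iff_real_differentiable)
    then have "((\<lambda>h. (l (fst z + h) (snd z) - l (fst z) (snd z)) / h) \<longlongrightarrow> d1_loss l (fst z) (snd z)) (at 0)"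
      by (simp add: DERIV_def)
    moreover have "filterlim (\<lambda>n. 1 / real (Suc n)) (at 0) sequentially"
      using LIMSEQ_inverse_real_of_nat by (intro filterlim_atI) (auto simp: inverse_eq_divide)
    ultimately show ?thesis
      by (rule filterlim_compose)
  qed
  then have "(\<lambda>z. d1_loss l (fst z) (snd z)) \<in> borel_measurable (borel :: (real \<times> real) measure)"
    by (rule borel_measurable_LIMSEQ_real) (rule meas)
  then show ?thesis
    by (simp add: case_prod_beta')
qed

lemma network_measurable:
  fixes \<pi> :: "('d::finite) param measure"
  assumes "\<pi> \<in> P2"
  shows "network \<pi> \<in> borel_measurable borel"
proof -
  interpret prob_space \<pi>
    using assms by (simp add: P2_def)
  \<comment> \<open>Measures in \<open>P2\<close> carry the Borel sets of
    \<open>closure Theta\<close>; the inclusion into the whole parameter space is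
    measurable.\<close>
  have [measurable]: "(\<lambda>\<theta>. \<theta>) \<in> \<pi> \<rightarrow>\<^sub>M borel"
    using assms measurable_restrict_space1[OF measurable_ident]
    by (simp add: P2_def id_def cong: measurable_cong_sets)
  have "continuous_on UNIV (\<lambda>z :: (real ^ 'd) \<times> 'd param. \<phi> (snd z) (fst z))"
    unfolding \<phi>_def relu_def case_prod_beta by (intro continuous_intros)
  then have "(\<lambda>z :: (real ^ 'd) \<times> 'd param. \<phi> (snd z) (fst z)) \<in> borel_measurable (borel \<Otimes>\<^sub>M borel)"
    unfolding borel_prod by (rule borel_measurable_continuous_onI)
  moreover have "(\<lambda>z. (fst z, snd z)) \<in> borel \<Otimes>\<^sub>M \<pi> \<rightarrow>\<^sub>M borel \<Otimes>\<^sub>M (borel :: 'd param measure)"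
    by measurable
  ultimately have "(\<lambda>z. \<phi> (snd (fst z, snd z)) (fst (fst z, snd z))) \<in> borel_measurable (borel \<Otimes>\<^sub>M \<pi>)"
    by (rule measurable_compose[rotated])
  then have "(\<lambda>(x, \<theta>). \<phi> \<theta> x) \<in> borel_measurable (borel \<Otimes>\<^sub>M \<pi>)"
    by (simp add: case_prod_beta')
  then show ?thesis
    unfolding network_def by (rule borel_measurable_lebesgue_integral)
qed

text \<open>This factor of the linearised risk is independent of the parameter and, for an
  admissible loss, bounded uniformly in \<open>\<pi>\<close>.\<close>

definition loss_weight :: "(real \<Rightarrow> real \<Rightarrow> real) \<Rightarrow> ('d::finite) param measure \<Rightarrow> (real ^ 'd) \<times> real \<Rightarrow> real"
  where "loss_weight l \<pi> z = d1_loss l (network \<pi> (fst z)) (snd z)"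

lemma loss_weight_measurable:
  fixes \<pi> :: "('d::finite) param measure"
  assumes "loss_assumption l" "\<pi> \<in> P2"
  shows "loss_weight l \<pi> \<in> borel_measurable borel"
proof -
  note [measurable] = network_measurable[OF assms(2)]
  have "(\<lambda>z :: (real ^ 'd) \<times> real. (network \<pi> (fst z), snd z)) \<in> borel \<rightarrow>\<^sub>M borel"
    unfolding borel_prod[symmetric] by measurable
  from measurable_compose[OF this d1_loss_measurable[OF assms(1)]] show ?thesis
    by (simp add: loss_weight_def[abs_def] comp_def)
qed

lemma integrable_norm_feature:
  fixes P :: "((real ^ 'd::finite) \<times> real) measure"
  assumes "data_assumption P"
  shows "integrable P (\<lambda>z. norm (feature z))"
proof -
  interpret prob_space P
    using assms by (simp add: data_assumption_def)
  have sP: "sets P = sets borel"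
    using assms by (simp add: data_assumption_def)
  have "integrable P (\<lambda>z. norm (fst z) + \<bar>snd z\<bar>)"
    using assms unfolding data_assumption_def case_prod_beta by blast
  then have "integrable P (\<lambda>z. (norm (fst z) + \<bar>snd z\<bar>) + 1)"
    by simp
  moreover have "(\<lambda>z. norm (feature z)) \<in> borel_measurable P"
    unfolding measurable_cong_sets[OF sP refl] by measurable
  moreover have "norm (feature z) \<le> norm ((norm (fst z) + \<bar>snd z\<bar>) + 1)" for z :: "(real ^ 'd) \<times> real"
    using norm_Pair_le[of "fst z" "1 :: real"] by (simp add: feature_def)
  then have "AE z in P. norm (norm (feature z)) \<le> norm ((norm (fst z) + \<bar>snd z\<bar>) + 1)"
    by simp
  ultimately show ?thesis
    by (rule Bochner_Integration.integrable_bound)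
qed

text \<open>Only measurability and a bound of the weight enter, so the constants derived here depend
  on \<open>C\<close> and \<open>P\<close> alone and hold uniformly along the flow.\<close>

locale weighted_data =
  fixes P :: "((real ^ 'd::finite) \<times> real) measure" and p :: "(real ^ 'd) \<times> real \<Rightarrow> real" and C :: real
  assumes data: "data_assumption P"
    and weight_measurable: "p \<in> borel_measurable borel"
    and weight_bound: "\<bar>p z\<bar> \<le> C"
begin

lemma sets_P: "sets P = sets borel"
  using data by (simp add: data_assumption_def)

lemma weight_measurable' [measurable]: "p \<in> borel_measurable P"
  using weight_measurable unfolding measurable_cong_sets[OF sets_P refl] .

lemma C_nonneg: "0 \<le> C"
  using weight_bound[of undefined] by linarith

lemma feature_measurable [measurable]: "feature \<in> borel_measurable P"
  unfolding measurable_cong_sets[OF sets_P refl] by measurable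

lemma integrable_ridge: "integrable P (\<lambda>z. p z * relu (u \<bullet> feature z))"
proof (rule Bochner_Integration.integrable_bound)
  show "integrable P (\<lambda>z. C * (norm u * norm (feature z)))"
    by (intro integrable_mult_right integrable_norm_feature data)
  show "AE z in P. norm (p z * relu (u \<bullet> feature z)) \<le> norm (C * (norm u * norm (feature z)))"
  proof (rule AE_I2)
    fix z
    have "\<bar>p z\<bar> * \<bar>relu (u \<bullet> feature z)\<bar> \<le> C * (norm u * norm (feature z))"
      using C_nonneg by (intro mult_mono weight_bound order_trans[OF abs_relu_le Cauchy_Schwarz_ineq2] mult_nonneg_nonneg) auto
    then show "norm (p z * relu (u \<bullet> feature z)) \<le> norm (C * (norm u * norm (feature z)))"
      using C_nonneg by (simp add: abs_mult)
  qed
qed measurable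

lemma integrable_ridge_gradient: "integrable P (\<lambda>z. (p z * relu' (u \<bullet> feature z)) *\<^sub>R feature z)"
proof (rule Bochner_Integration.integrable_bound)
  show "integrable P (\<lambda>z. C * norm (feature z))"
    by (intro integrable_mult_right integrable_norm_feature data)
  show "AE z in P. norm ((p z * relu' (u \<bullet> feature z)) *\<^sub>R feature z) \<le> norm (C * norm (feature z))"
  proof (rule AE_I2)
    fix z
    have "\<bar>p z\<bar> * \<bar>relu' (u \<bullet> feature z)\<bar> \<le> C * 1"
      using C_nonneg by (intro mult_mono weight_bound abs_relu'_le) auto
    then have "\<bar>p z\<bar> * \<bar>relu' (u \<bullet> feature z)\<bar> * norm (feature z) \<le> C * norm (feature z)"
      by (intro mult_right_mono) auto
    then show "norm ((p z * relu' (u \<bullet> feature z)) *\<^sub>R feature z) \<le> norm (C * norm (feature z))"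
      using C_nonneg by (simp add: abs_mult)
  qed
qed measurable

lemma inner_ridge_gradient:
  "v \<bullet> ridge_gradient P p u = (\<integral>z. p z * (relu' (u \<bullet> feature z) * (v \<bullet> feature z)) \<partial>P)"
  and integrable_inner_ridge_gradient:
  "integrable P (\<lambda>z. p z * (relu' (u \<bullet> feature z) * (v \<bullet> feature z)))"
proof -
  have eq: "p z * (relu' (u \<bullet> feature z) * (v \<bullet> feature z))
      = v \<bullet> ((p z * relu' (u \<bullet> feature z)) *\<^sub>R feature z)" for z
    by (simp only: inner_scaleR_right mult.assoc)
  show "v \<bullet> ridge_gradient P p u = (\<integral>z. p z * (relu' (u \<bullet> feature z) * (v \<bullet> feature z)) \<partial>P)"
    unfolding eq ridge_gradient_def by (rule integral_inner_right[symmetric]) (rule integrable_ridge_gradient)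
  show "integrable P (\<lambda>z. p z * (relu' (u \<bullet> feature z) * (v \<bullet> feature z)))"
    unfolding eq by (intro integrable_inner_right integrable_ridge_gradient)
qed

text \<open>The identity already holds pointwise in the integrand, by
  \<open>relu' r * r = relu r\<close>, without differentiating under the integral.\<close>

lemma euler: "u \<bullet> ridge_gradient P p u = ridge_integral P p u"
  by (simp only: inner_ridge_gradient ridge_integral_def relu_eq)

lemma ridge_integral_scale:
  assumes "0 < c"
  shows "ridge_integral P p (c *\<^sub>R u) = c * ridge_integral P p u"
proof -
  have "p z * relu ((c *\<^sub>R u) \<bullet> feature z) = c * (p z * relu (u \<bullet> feature z))" for z
    by (simp add: relu_scale[OF assms])
  then show ?thesis
    unfolding ridge_integral_def by (simp only: integral_mult_right_zero)
qed

lemma ridge_gradient_scale: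
  assumes "0 < c"
  shows "ridge_gradient P p (c *\<^sub>R u) = ridge_gradient P p u"
  unfolding ridge_gradient_def by (simp only: inner_scaleR_left relu'_scale[OF assms])

lemma ridge_integral_lipschitz:
  "\<bar>ridge_integral P p v - ridge_integral P p u\<bar> \<le> C * (\<integral>z. norm (feature z) \<partial>P) * dist v u"
proof -
  have "ridge_integral P p v - ridge_integral P p u
      = (\<integral>z. p z * relu (v \<bullet> feature z) - p z * relu (u \<bullet> feature z) \<partial>P)"
    unfolding ridge_integral_def by (intro Bochner_Integration.integral_diff[symmetric] integrable_ridge)
  also have "\<bar>\<dots>\<bar> \<le> (\<integral>z. C * dist v u * norm (feature z) \<partial>P)"
  proof (rule order_trans[OF integral_abs_bound], rule integral_mono')
    show "integrable P (\<lambda>z. C * dist v u * norm (feature z))"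
      by (intro integrable_mult_right integrable_norm_feature data)
    fix z
    have "\<bar>p z\<bar> * \<bar>relu (v \<bullet> feature z) - relu (u \<bullet> feature z)\<bar> \<le> C * \<bar>(v - u) \<bullet> feature z\<bar>"
      using C_nonneg unfolding inner_diff_left by (intro mult_mono weight_bound abs_relu_diff_le) auto
    also have "\<dots> \<le> C * (norm (v - u) * norm (feature z))"
      using C_nonneg by (intro mult_left_mono Cauchy_Schwarz_ineq2)
    finally show "\<bar>p z * relu (v \<bullet> feature z) - p z * relu (u \<bullet> feature z)\<bar> \<le> C * dist v u * norm (feature z)"
      by (simp only: abs_mult dist_norm mult.assoc flip: right_diff_distrib)
    show "0 \<le> C * dist v u * norm (feature z)"
      using C_nonneg by simp
  qed
  finally show ?thesis
    by (simp add: mult_ac)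
qed

lemma integrable_indicator_diff:
  "integrable P (\<lambda>z. \<bar>relu' (v \<bullet> feature z) - relu' (u \<bullet> feature z)\<bar> * norm (feature z))"
proof (rule Bochner_Integration.integrable_bound)
  show "integrable P (\<lambda>z. norm (feature z))"
    by (intro integrable_norm_feature data)
  show "AE z in P. norm (\<bar>relu' (v \<bullet> feature z) - relu' (u \<bullet> feature z)\<bar> * norm (feature z))
      \<le> norm (norm (feature z))"
    by (intro AE_I2) (auto simp: relu'_def)
qed measurable

text \<open>This brings the half-space condition to the form that occurs in the Taylor remainder:
  the density is the norm of the feature.\<close>

lemma indicator_diff_eq:
  "(\<integral>x. \<bar>indicator {x. fst v \<bullet> x + snd v > 0} x - indicator {x. fst u \<bullet> x + snd u > 0} x\<bar>
      \<partial>density (marginal P) (\<lambda>x. ennreal (sqrt (1 + (norm x)\<^sup>2))))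
    = (\<integral>z. \<bar>relu' (v \<bullet> feature z) - relu' (u \<bullet> feature z)\<bar> * norm (feature z) \<partial>P)"
proof -
  have [measurable]: "fst \<in> borel_measurable P"
    unfolding measurable_cong_sets[OF sets_P refl]
    by (intro borel_measurable_continuous_onI continuous_intros)
  let ?f = "\<lambda>x. \<bar>relu' (fst v \<bullet> x + snd v) - relu' (fst u \<bullet> x + snd u)\<bar>"
  have ind: "indicator {x. fst v \<bullet> x + snd v > 0} x = relu' (fst v \<bullet> x + snd v)" for x and v :: "(real ^ 'd) \<times> real"
    by (simp add: relu'_def indicator_def)
  have "(\<integral>x. ?f x \<partial>density (marginal P) (\<lambda>x. ennreal (sqrt (1 + (norm x)\<^sup>2))))
      = (\<integral>x. sqrt (1 + (norm x)\<^sup>2) *\<^sub>R ?f x \<partial>marginal P)"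
    unfolding marginal_def by (intro integral_density) (auto intro!: AE_I2)
  also have "\<dots> = (\<integral>z. sqrt (1 + (norm (fst z))\<^sup>2) *\<^sub>R ?f (fst z) \<partial>P)"
    unfolding marginal_def by (intro integral_distr) auto
  finally show ?thesis
    unfolding ind by (simp add: norm_feature inner_feature mult.commute)
qed

text \<open>One factor \<open>dist v u\<close> comes from Cauchy-Schwarz. The other comes from the
  half-space condition, because the pointwise remainder vanishes unless \<open>u\<close> and
  \<open>v\<close> activate the data point differently.\<close>

lemma ridge_integral_taylor:
  assumes "(\<integral>x. \<bar>indicator {x. fst v \<bullet> x + snd v > 0} x - indicator {x. fst u \<bullet> x + snd u > 0} x\<bar>
      \<partial>density (marginal P) (\<lambda>x. ennreal (sqrt (1 + (norm x)\<^sup>2)))) \<le> L * dist v u"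
  shows "\<bar>ridge_integral P p v - ridge_integral P p u - (v - u) \<bullet> ridge_gradient P p u\<bar> \<le> C * L * (dist v u)\<^sup>2"
proof -
  let ?I = "\<lambda>z. \<bar>relu' (v \<bullet> feature z) - relu' (u \<bullet> feature z)\<bar> * norm (feature z)"
  have eq: "ridge_integral P p v - ridge_integral P p u - (v - u) \<bullet> ridge_gradient P p u
      = (\<integral>z. p z * relu (v \<bullet> feature z) - p z * relu (u \<bullet> feature z) - p z * (relu' (u \<bullet> feature z) * ((v - u) \<bullet> feature z)) \<partial>P)"
    using Bochner_Integration.integral_diff[OF Bochner_Integration.integrable_diff[OF
          integrable_ridge[of v] integrable_ridge[of u]] integrable_inner_ridge_gradient[of u "v - u"]]
      Bochner_Integration.integral_diff[OF integrable_ridge[of v] integrable_ridge[of u]]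
    by (simp only: inner_ridge_gradient ridge_integral_def)
  have "\<bar>ridge_integral P p v - ridge_integral P p u - (v - u) \<bullet> ridge_gradient P p u\<bar>
      \<le> (\<integral>z. C * dist v u * ?I z \<partial>P)"
    unfolding eq
  proof (rule order_trans[OF integral_abs_bound], rule integral_mono')
    show "integrable P (\<lambda>z. C * dist v u * ?I z)"
      by (intro integrable_mult_right integrable_indicator_diff)
    fix z
    have "\<bar>p z * relu (v \<bullet> feature z) - p z * relu (u \<bullet> feature z) - p z * (relu' (u \<bullet> feature z) * ((v - u) \<bullet> feature z))\<bar>
        = \<bar>p z\<bar> * \<bar>relu (v \<bullet> feature z) - relu (u \<bullet> feature z) - relu' (u \<bullet> feature z) * (v \<bullet> feature z - u \<bullet> feature z)\<bar>"
      unfolding inner_diff_left right_diff_distrib[symmetric] abs_mult ..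
    also have "\<dots> \<le> C * (\<bar>relu' (v \<bullet> feature z) - relu' (u \<bullet> feature z)\<bar> * \<bar>v \<bullet> feature z - u \<bullet> feature z\<bar>)"
      using C_nonneg by (intro mult_mono weight_bound relu_taylor) auto
    also have "\<dots> \<le> C * (\<bar>relu' (v \<bullet> feature z) - relu' (u \<bullet> feature z)\<bar> * (dist v u * norm (feature z)))"
      unfolding inner_diff_left[symmetric] dist_norm
      using C_nonneg by (intro mult_left_mono Cauchy_Schwarz_ineq2) auto
    finally show "\<bar>p z * relu (v \<bullet> feature z) - p z * relu (u \<bullet> feature z) - p z * (relu' (u \<bullet> feature z) * ((v - u) \<bullet> feature z))\<bar>
        \<le> C * dist v u * ?I z"
      by (simp only: mult_ac)
    show "0 \<le> C * dist v u * ?I z"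
      using C_nonneg by simp
  qed
  also have "\<dots> = C * dist v u * (\<integral>z. ?I z \<partial>P)"
    by (rule integral_mult_right_zero)
  also have "\<dots> \<le> C * dist v u * (L * dist v u)"
    using assms C_nonneg unfolding indicator_diff_eq by (intro mult_left_mono) auto
  finally show ?thesis
    by (simp add: power2_eq_square mult_ac)
qed

end

section \<open>The linearised risk and its gradient as ridge integrals\<close>

lemma dR_eq: "dR l P \<pi> (a, u) = a * ridge_integral P (loss_weight l \<pi>) u"
proof -
  have "d1_loss l (network \<pi> (fst z)) (snd z) * \<phi> (a, u) (fst z) = a * (loss_weight l \<pi> z * relu (u \<bullet> feature z))" for z
    by (simp add: \<phi>_def loss_weight_def case_prod_beta inner_feature)
  then show ?thesis
    unfolding dR_def ridge_integral_def case_prod_beta by simp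
qed

lemma grad_dR_eq:
  assumes "weighted_data P (loss_weight l \<pi>) C"
  shows "grad_dR l P \<pi> (a, u) = (ridge_integral P (loss_weight l \<pi>) u, a *\<^sub>R ridge_gradient P (loss_weight l \<pi>) u)"
proof -
  interpret weighted_data P "loss_weight l \<pi>" C
    by fact
  let ?f = "\<lambda>z. loss_weight l \<pi> z * relu (u \<bullet> feature z)"
  let ?g = "\<lambda>z. (loss_weight l \<pi> z * relu' (u \<bullet> feature z)) *\<^sub>R feature z"
  have eq: "d1_loss l (network \<pi> (fst z)) (snd z) *\<^sub>R grad_\<phi> (a, u) (fst z) = (?f z, a *\<^sub>R ?g z)" for z
    by (simp add: grad_\<phi>_def loss_weight_def case_prod_beta inner_feature mult_ac) (simp add: feature_def)
  \<comment> \<open>Integrability of the pair is required to interchange the Bochner integral with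
    the two projections.\<close>
  have int: "integrable P (\<lambda>z. (?f z, 0 :: (real ^ 'a) \<times> real) + (0, a *\<^sub>R ?g z))"
    by (intro Bochner_Integration.integrable_add
        integrable_bounded_linear[OF bounded_linear_Pair[OF bounded_linear_ident bounded_linear_zero], of P ?f]
        integrable_bounded_linear[OF bounded_linear_Pair[OF bounded_linear_zero bounded_linear_ident], of P "\<lambda>z. a *\<^sub>R ?g z"]
        integrable_ridge integrable_scaleR_right integrable_ridge_gradient)
  then have int: "integrable P (\<lambda>z. (?f z, a *\<^sub>R ?g z))"
    by simp
  show ?thesis
  proof (rule prod_eqI)
    show "fst (grad_dR l P \<pi> (a, u)) = fst (ridge_integral P (loss_weight l \<pi>) u, a *\<^sub>R ridge_gradient P (loss_weight l \<pi>) u)"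
      unfolding grad_dR_def case_prod_beta eq ridge_integral_def
      by (subst integral_bounded_linear[OF bounded_linear_fst int, symmetric]) simp
    have "snd (\<integral>z. (?f z, a *\<^sub>R ?g z) \<partial>P) = (\<integral>z. a *\<^sub>R ?g z \<partial>P)"
      by (subst integral_bounded_linear[OF bounded_linear_snd int, symmetric]) simp
    then show "snd (grad_dR l P \<pi> (a, u)) = snd (ridge_integral P (loss_weight l \<pi>) u, a *\<^sub>R ridge_gradient P (loss_weight l \<pi>) u)"
      unfolding grad_dR_def case_prod_beta eq ridge_gradient_def integral_scaleR_right by simp
  qed
qed

lemma weighted_data_loss_weight:
  assumes "data_assumption P" "loss_assumption l" "\<pi> \<in> P2" "\<And>u y. \<bar>d1_loss l u y\<bar> \<le> C"
  shows "weighted_data P (loss_weight l \<pi>) C"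
  using assms loss_weight_measurable[OF assms(2,3)] by unfold_locales (auto simp: loss_weight_def)

subsection \<open>The Morse-Sard condition\<close>

text \<open>Scaling \<open>a\<close> by \<open>n / (n + 1)\<close> makes the inequality strict; for
  \<open>a = 0\<close> it is strict because \<open>u \<noteq> 0\<close>. This gives access to limits
  on the boundary of the cone.\<close>

lemma mem_closure_Theta:
  assumes "\<bar>a\<bar> \<le> norm u" "u \<noteq> 0"
  shows "(a, u) \<in> closure (Theta :: ('d::finite) param set)"
  unfolding closure_sequential
proof (intro exI conjI allI)
  let ?c = "\<lambda>n. real n / real (Suc n)"
  show "(?c n * a, u) \<in> Theta" for n
  proof -
    have "\<bar>?c n * a\<bar> < norm u"
    proof (cases "a = 0")
      case False
      have "\<bar>?c n * a\<bar> = ?c n * \<bar>a\<bar>"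
        by (simp add: abs_mult)
      also have "\<dots> < 1 * \<bar>a\<bar>"
        using False by (intro mult_strict_right_mono) (auto simp: field_simps)
      finally show ?thesis
        using assms(1) by simp
    qed (use assms(2) in auto)
    then have "\<bar>?c n * a\<bar>\<^sup>2 < (norm u)\<^sup>2"
      by (intro power_strict_mono) auto
    then have "(?c n * a)\<^sup>2 < (norm u)\<^sup>2"
      by (simp only: power2_abs)
    then show ?thesis
      by (cases u) (simp add: Theta_def norm_Pair)
  qed
  have "(\<lambda>n. (?c n * a, u)) \<longlonglongrightarrow> (1 * a, u)"
    by (intro tendsto_Pair tendsto_mult tendsto_const LIMSEQ_n_over_Suc_n)
  then show "(\<lambda>n. (?c n * a, u)) \<longlonglongrightarrow> (a, u)"
    by simp
qed

theorem mainTheorem6: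
  fixes l :: "real \<Rightarrow> real \<Rightarrow> real"
    and P :: "((real ^ 2) \<times> real) measure"
    and K :: "real ^ 2 \<Rightarrow> real measure"
    and \<pi>\<^sub>0 :: "2 param measure"
    and \<pi> :: "real \<Rightarrow> 2 param measure"
  assumes "loss_assumption l"
    and "data_assumption P"
    and "conditional_distribution P K"
    and "compatibility l P K"
    and "\<pi>\<^sub>0 \<in> P2"
    and "wasserstein_gradient_flow l P \<pi>\<^sub>0 \<pi>"
  shows "morse_sard_condition l P \<pi>"
  unfolding morse_sard_condition_def
proof (intro allI impI, elim conjE)
  fix t :: "nat \<Rightarrow> real" and g :: "2 param \<Rightarrow> real" and V :: "2 param \<Rightarrow> 2 param"
  assume t: "\<forall>n. 0 \<le> t n"
    and lim_g: "locally_uniform_limit (closure Theta) (\<lambda>n. dR l P (\<pi> (t n))) g"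
    and lim_V: "locally_uniform_limit (closure Theta) (\<lambda>n. grad_dR l P (\<pi> (t n))) V"
  obtain C where C: "\<And>u y. \<bar>d1_loss l u y\<bar> \<le> C"
    using assms(1) unfolding loss_assumption_def by blast
  obtain L where L: "\<And>u v. u \<in> sphere 0 1 \<Longrightarrow> v \<in> sphere 0 1 \<Longrightarrow>
      (\<integral>x. \<bar>indicator {x. fst u \<bullet> x + snd u > 0} x - indicator {x. fst v \<bullet> x + snd v > 0} x\<bar>
           \<partial>density (marginal P) (\<lambda>x. ennreal (sqrt (1 + (norm x)\<^sup>2)))) \<le> L * dist u v"
    using assms(2) unfolding data_assumption_def by blast
  define H where "H n = ridge_integral P (loss_weight l (\<pi> (t n)))" for n
  define D where "D n = ridge_gradient P (loss_weight l (\<pi> (t n)))" for n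
  \<comment> \<open>The same \<open>C\<close> serves every \<open>n\<close>, so the estimates below
    pass to the limit.\<close>
  have wd: "weighted_data P (loss_weight l (\<pi> (t n))) C" for n
    using assms(1,2,6) t C by (intro weighted_data_loss_weight) (auto simp: wasserstein_gradient_flow_def)
  have H_scale: "H n (c *\<^sub>R u) = c * H n u" and D_scale: "D n (c *\<^sub>R u) = D n u" if "0 < c" for n c u
    unfolding H_def D_def using weighted_data.ridge_integral_scale[OF wd that]
      weighted_data.ridge_gradient_scale[OF wd that] by auto
  define B where "B = C * (\<integral>z. norm (feature z) \<partial>P)"
  have H_lipschitz: "\<bar>H n v - H n u\<bar> \<le> B * dist v u" for n u v
    unfolding H_def B_def by (rule weighted_data.ridge_integral_lipschitz[OF wd])
  have H_zero: "H n 0 = 0" for n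
    by (simp add: H_def ridge_integral_def relu_def)
  have H_taylor: "\<bar>H n v - H n u - (v - u) \<bullet> D n u\<bar> \<le> C * L * (dist v u)\<^sup>2"
    if "norm u = 1" "norm v = 1" for n u v
    unfolding H_def D_def using that by (intro weighted_data.ridge_integral_taylor[OF wd] L) auto
  have g: "(\<lambda>n. fst \<theta> * H n (snd \<theta>)) \<longlonglongrightarrow> g \<theta>"
    and V: "(\<lambda>n. (H n (snd \<theta>), fst \<theta> *\<^sub>R D n (snd \<theta>))) \<longlonglongrightarrow> V \<theta>" if "\<theta> \<in> closure Theta" for \<theta>
  proof -
    have "(\<lambda>n. dR l P (\<pi> (t n)) \<theta>) \<longlonglongrightarrow> g \<theta>" "(\<lambda>n. grad_dR l P (\<pi> (t n)) \<theta>) \<longlonglongrightarrow> V \<theta>"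
      using lim_g[unfolded locally_uniform_limit_def, rule_format, of "{\<theta>}"]
        lim_V[unfolded locally_uniform_limit_def, rule_format, of "{\<theta>}"] that by simp_all
    then show "(\<lambda>n. fst \<theta> * H n (snd \<theta>)) \<longlonglongrightarrow> g \<theta>"
      and "(\<lambda>n. (H n (snd \<theta>), fst \<theta> *\<^sub>R D n (snd \<theta>))) \<longlonglongrightarrow> V \<theta>"
      using dR_eq[of l P _ "fst \<theta>" "snd \<theta>"] grad_dR_eq[OF wd, of _ "fst \<theta>" "snd \<theta>"] by (simp_all add: H_def D_def)
  qed
  \<comment> \<open>\<open>(r, r u)\<close> is the unit vector of the cone above \<open>u\<close> at which \<open>a\<^sup>2 = 1/2\<close>, the only place where
    critical points with nonzero value occur.\<close>
  define r where "r = 1 / sqrt 2"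
  have r: "0 < r" "r * r = 1 / 2"
    by (simp_all add: r_def)
  \<comment> \<open>By homogeneity \<open>r * H n (r *\<^sub>R u) = H n u / 2\<close>, so the factor
    2 makes \<open>h\<close> the limit of \<open>H n\<close> on the unit sphere.\<close>
  define h where "h u = 2 * g (r, r *\<^sub>R u)" for u
  have h: "(\<lambda>n. H n u) \<longlonglongrightarrow> h u" if "norm u = 1" for u
  proof -
    have "(r, r *\<^sub>R u) \<in> closure Theta"
      using that r by (intro mem_closure_Theta) auto
    moreover have "2 * (r * H n (r *\<^sub>R u)) = H n u" for n
      by (simp only: H_scale[OF r(1)] mult.assoc[of r, symmetric] r(2))
    ultimately show ?thesis
      using tendsto_mult[OF tendsto_const[of 2] g, of "(r, r *\<^sub>R u)"] by (simp add: h_def)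
  qed
  have h_lipschitz: "\<bar>h v - h u\<bar> \<le> B * dist v u" if "norm u = 1" "norm v = 1" for u v
    by (rule LIMSEQ_le_const2[OF tendsto_rabs[OF tendsto_diff[OF h[OF that(2)] h[OF that(1)]]]])
      (use H_lipschitz in blast)
  have h_bound: "\<bar>h u\<bar> \<le> B" if "norm u = 1" for u
    by (rule LIMSEQ_le_const2[OF tendsto_rabs[OF h[OF that]]])
      (use H_lipschitz[of _ u 0] that in \<open>simp add: H_zero\<close>)
  \<comment> \<open>\<open>C * L\<close> bounds the Taylor remainder; \<open>B / 2\<close> bounds
    the first-order term of a radial gradient, which on the sphere is itself quadratic in the
    distance.\<close>
  define M where "M = C * L + B / 2"
  define W where "W = h ` {u \<in> sphere 0 1. \<forall>v \<in> sphere 0 1. \<bar>h v - h u\<bar> \<le> M * (dist v u)\<^sup>2}"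
  have "continuous_on (sphere 0 1) h"
  proof (rule lipschitz_on_continuous_on)
    show "\<bar>B\<bar>-lipschitz_on (sphere 0 1) h"
    proof (rule lipschitz_onI)
      fix u v :: "(real ^ 2) \<times> real"
      assume "u \<in> sphere 0 1" "v \<in> sphere 0 1"
      then have "dist (h u) (h v) \<le> B * dist u v"
        using h_lipschitz[of v u] by (simp add: dist_real_def)
      also have "\<dots> \<le> \<bar>B\<bar> * dist u v"
        by (intro mult_right_mono) auto
      finally show "dist (h u) (h v) \<le> \<bar>B\<bar> * dist u v" .
    qed auto
  qed
  then have "negligible W"
    unfolding W_def by (rule quadratic_critical_values_negligible)
  \<comment> \<open>The value 0 is set aside. Any other critical value is \<open>h u / 2\<close> or
    \<open>- h u / 2\<close> for a critical point \<open>u\<close> of \<open>h\<close>, according to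
    the sign of \<open>a\<close>.\<close>
  have critical: "g \<theta> \<in> {0} \<union> (\<lambda>s. s / 2) ` W \<union> (\<lambda>s. - s / 2) ` W"
    if \<theta>: "\<theta> \<in> closure Theta" "norm \<theta> = 1" and tang: "tangential \<theta> (V \<theta>) = 0" for \<theta>
  proof (cases "g \<theta> = 0")
    case False
    define a where "a = fst \<theta>"
    define u' where "u' = snd \<theta>"
    have lim1: "(\<lambda>n. H n u') \<longlonglongrightarrow> fst (V \<theta>)" and lim2: "(\<lambda>n. a *\<^sub>R D n u') \<longlonglongrightarrow> snd (V \<theta>)"
      using tendsto_fst[OF V[OF \<theta>(1)]] tendsto_snd[OF V[OF \<theta>(1)]] by (simp_all add: a_def u'_def)
    have g': "(\<lambda>n. a * H n u') \<longlonglongrightarrow> g \<theta>"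
      using g[OF \<theta>(1)] by (simp add: a_def u'_def)
    have g1: "g \<theta> = a * fst (V \<theta>)"
      using LIMSEQ_unique[OF g' tendsto_mult[OF tendsto_const lim1]] .
    have "u' \<bullet> D n u' = H n u'" for n
      using weighted_data.euler[OF wd, of u' n] by (simp add: H_def D_def)
    then have g2: "g \<theta> = u' \<bullet> snd (V \<theta>)"
      using LIMSEQ_unique[OF g'] tendsto_inner[OF tendsto_const[of u'] lim2] by simp
    \<comment> \<open>The linearised risk is linear in \<open>a\<close> and homogeneous of degree
      one in \<open>u'\<close>, so each block contributes \<open>g \<theta>\<close>. If the
      tangential part vanishes, \<open>V \<theta>\<close> is therefore radial with factor
      \<open>2 * g \<theta>\<close>.\<close>
    have "\<theta> \<bullet> V \<theta> = 2 * g \<theta>"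
      using g1 g2 by (simp add: inner_prod_def a_def u'_def)
    then have V_eq: "V \<theta> = (2 * g \<theta>) *\<^sub>R \<theta>"
      using tang by (simp add: tangential_def)
    then have V1: "fst (V \<theta>) = 2 * g \<theta> * a" and V2: "snd (V \<theta>) = (2 * g \<theta>) *\<^sub>R u'"
      by (simp_all add: a_def u'_def)
    have "a * a = 1 / 2"
      using g1 False unfolding V1 by (simp add: field_simps)
    then have "a \<noteq> 0"
      by auto
    have "a\<^sup>2 + (norm u')\<^sup>2 = 1"
      using \<theta>(2) norm_Pair[of a u'] by (simp add: a_def u'_def)
    then have nu': "(norm u')\<^sup>2 = 1 / 2"
      using \<open>a * a = 1 / 2\<close> by (simp add: power2_eq_square)
    define u where "u = sqrt 2 *\<^sub>R u'"
    have "(norm u)\<^sup>2 = 1"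
      by (simp add: u_def power_mult_distrib nu')
    then have nu: "norm u = 1"
      using power2_eq_iff_nonneg[of "norm u" 1] by simp
    have "(\<lambda>n. sqrt 2 * H n u') \<longlonglongrightarrow> sqrt 2 * fst (V \<theta>)"
      by (intro tendsto_mult tendsto_const lim1)
    then have "(\<lambda>n. H n u) \<longlonglongrightarrow> sqrt 2 * (2 * g \<theta> * a)"
      by (simp add: u_def H_scale V1)
    then have hu: "h u = sqrt 2 * (2 * g \<theta> * a)"
      using LIMSEQ_unique h[OF nu] by blast
    \<comment> \<open>Since \<open>a \<noteq> 0\<close>, the gradients \<open>D n u\<close>
      themselves converge. Their limit is radial, so \<open>h\<close> has no tangential first-order
      term at \<open>u\<close>.\<close>
    have "(\<lambda>n. (1 / a) *\<^sub>R (a *\<^sub>R D n u')) \<longlonglongrightarrow> (1 / a) *\<^sub>R ((2 * g \<theta>) *\<^sub>R u')"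
      unfolding V2[symmetric] by (intro tendsto_scaleR tendsto_const lim2)
    moreover have "(1 / a) *\<^sub>R (a *\<^sub>R D n u') = D n u" for n
      using \<open>a \<noteq> 0\<close> by (simp add: u_def D_scale)
    moreover have "(1 / a) *\<^sub>R ((2 * g \<theta>) *\<^sub>R u') = h u *\<^sub>R u"
    proof -
      have "1 / a = 2 * a"
        using \<open>a * a = 1 / 2\<close> \<open>a \<noteq> 0\<close> by (simp add: field_simps)
      then have "(1 / a) * (2 * g \<theta>) = h u * sqrt 2"
        unfolding hu by (simp only:) simp
      then show ?thesis
        by (simp only: scaleR_scaleR u_def)
    qed
    ultimately have Du: "(\<lambda>n. D n u) \<longlonglongrightarrow> h u *\<^sub>R u"
      by simp
    have "\<bar>h v - h u\<bar> \<le> M * (dist v u)\<^sup>2" if "norm v = 1" for v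
    proof -
      have lim: "(\<lambda>n. \<bar>H n v - H n u - (v - u) \<bullet> D n u\<bar>) \<longlonglongrightarrow> \<bar>h v - h u - (v - u) \<bullet> (h u *\<^sub>R u)\<bar>"
        by (intro tendsto_intros h that nu Du)
      have taylor: "\<bar>h v - h u - (v - u) \<bullet> (h u *\<^sub>R u)\<bar> \<le> C * L * (dist v u)\<^sup>2"
        by (rule LIMSEQ_le_const2[OF lim]) (use H_taylor[OF nu that] in blast)
      \<comment> \<open>Between unit vectors the radial component of \<open>v - u\<close> is only
        quadratic in the distance, so the radial first-order term can be absorbed into the
        remainder.\<close>
      have "(dist v u)\<^sup>2 = 2 - 2 * (v \<bullet> u)"
        using that nu by (simp add: dist_norm power2_norm_eq_inner inner_diff inner_commute norm_eq_1)
      then have "(v - u) \<bullet> u = - ((dist v u)\<^sup>2 / 2)"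
        using nu by (simp add: inner_diff_left norm_eq_1 field_simps)
      then have "\<bar>(v - u) \<bullet> (h u *\<^sub>R u)\<bar> = \<bar>h u\<bar> * (dist v u)\<^sup>2 / 2"
        by (simp add: abs_mult)
      also have "\<dots> \<le> B * (dist v u)\<^sup>2 / 2"
        by (intro divide_right_mono mult_right_mono h_bound nu) auto
      finally have "\<bar>h v - h u\<bar> \<le> C * L * (dist v u)\<^sup>2 + B * (dist v u)\<^sup>2 / 2"
        using taylor by linarith
      then show ?thesis
        by (simp add: M_def algebra_simps)
    qed
    then have "h u \<in> W"
      unfolding W_def using nu by auto
    \<comment> \<open>For \<open>a = r\<close> the formula for \<open>h u\<close> reads
      \<open>h u = 2 * g \<theta>\<close>; for \<open>a = - r\<close> the sign flips.\<close>
    have "a = r \<or> a = - r"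
      using \<open>a * a = 1 / 2\<close> r(2) by (metis square_eq_iff)
    then have "g \<theta> = h u / 2 \<or> g \<theta> = - h u / 2"
      by (auto simp: hu r_def)
    then show ?thesis
      using \<open>h u \<in> W\<close> by blast
  qed simp
  have "negligible ((\<lambda>s. s / 2) ` W)" "negligible ((\<lambda>s. - s / 2) ` W)"
    by (intro negligible_differentiable_image_negligible order_refl \<open>negligible W\<close>
        linear_imp_differentiable_on linearI; simp add: field_simps)+
  then have "{0} \<union> (\<lambda>s. s / 2) ` W \<union> (\<lambda>s. - s / 2) ` W \<in> null_sets lebesgue"
    by (simp flip: negligible_iff_null_sets)
  then show "AE s in lebesgue. \<forall>\<theta> \<in> {\<theta> \<in> closure Theta. norm \<theta> = 1 \<and> g \<theta> = s}. tangential \<theta> (V \<theta>) \<noteq> 0"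
    by (rule AE_I') (use critical in blast)
qed

end
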